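(* Let $\tilde F_i:\tilde X\to Y$, $i=0,\dots,r_{\mathrm{num}}-1$, be the linear MRI operators described in the context, let $\mathcal P_0\in\tilde X$ and $\rho>0$, and let $\mathcal M_0,\dots,\mathcal M_{r_{\mathrm{num}}-1}\in Y$. Assume there exists $\mathcal P^*\in B_{\rho/2}(\mathcal P_0)$ with $\tilde F_i(\mathcal P^* )=\mathcal M_i$ for all $i=0,\dots,r_{\mathrm{num}}-1$. Let $\{\boldsymbol\delta_m\}_{m\in\mathbb N}$, $\boldsymbol\delta_m=(\delta_{0,m},\dots,\delta_{r_{\mathrm{num}}-1,m})$ with $\delta_{i,m}>0$, be a sequence such that $\lim_{m\to\infty}\max_i\delta_{i,m}=0$, and let $\mathcal M_i^{\boldsymbol\delta_m}\in Y$ be noisy data with $\|\mathcal M_i^{\boldsymbol\delta_m}-\mathcal M_i\|\le\delta_{i,m}$ for all $i=0,\dots,r_{\mathrm{num}}-1$ and $m\in\mathbb N$. For each $m$, let $(\mathcal P_k^{\boldsymbol\delta_m})_{k\ge0}$ be the loping Steepest-Descent Kaczmarz (lSDK) iteration started at $\mathcal P_0$ with data $\mathcal M_i^{\boldsymbol\delta_m}$ and noise levels $\delta_{i,m}$, and let $k_*^m$ be its stopping index. Then the iterates $\mathcal P_{k_*^m}^{\boldsymbol\delta_m}$ converge, as $m\to\infty$, to a solution of the system $\tilde F_i(\mathcal P)=\mathcal M_i$, $i=0,\dots,r_{\mathrm{num}}-1$.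
   Context: Discrete MRI model. Let $p_{\mathrm{hor}},p_{\mathrm{ver}},r_{\mathrm{num}},b_{\mathrm{num}}$ be positive integers, $p_{\mathrm{num}}=p_{\mathrm{hor}}p_{\mathrm{ver}}$, and $\mathbb B=\{1,\dots,p_{\mathrm{hor}}\}\times\{1,\dots,p_{\mathrm{ver}}\}$, identified via a fixed enumeration with $\{0,\dots,p_{\mathrm{num}}-1\}$. Let $\mathbb M\subset\mathbb B$ be a given subset. Let $\tilde X=\{f\mid f:\mathbb B\to\mathbb C\}$ and $Y=\{g\mid g:\mathbb M\to\mathbb C\}$, with Euclidean norms $\|\cdot\|$ and inner products. The discrete Fourier transform $\mathcal F:\tilde X\to\tilde X$ is $(\mathcal F f)(m)=\sum_{n=0}^{p_{\mathrm{num}}-1}f(n)\exp(-2\pi i\,nm/p_{\mathrm{num}})$, and $\mathbf P:\tilde X\to Y$ is restriction, $(\mathbf P[f])(m)=f(m)$ for $m\in\mathbb M$. Let $\mathcal B_n:\mathbb B\to\mathbb C$ ($n=1,\dots,b_{\mathrm{num}}$) be given basis functions and $b_{j,n}\in\mathbb C$ ($j=0,\dots,r_{\mathrm{num}}-1$) known coefficients. Define the linear operators $$\tilde F_i(\mathcal P)=\sum_{n=1}^{b_{\mathrm{num}}}b_{i,n}\,\mathbf P[\mathcal F(\mathcal P\times\mathcal B_n)],\qquad i=0,\dots,r_{\mathrm{num}}-1,$$ where $\times$ is the pointwise product. $\tilde F_i^*$ denotes the adjoint and $B_r(\cdot)$ the ball of radius $r$. lSDK iteration for data $\mathcal M_i^\delta\in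 Y$ and noise levels $\delta_i$. Fix a constant $\tau>2$ and put $[k]=k \bmod r_{\mathrm{num}}\in\{0,\dots,r_{\mathrm{num}}-1\}$. A group of $r_{\mathrm{num}}$ subsequent steps starting at a multiple of $r_{\mathrm{num}}$ is called a cycle. Starting with $\mathcal P_0^\delta=\mathcal P_0$, set $$\mathcal P_{k+1}^\delta=\mathcal P_k^\delta-\omega_k\alpha_k s_k,\qquad s_k=\tilde F_{[k]}^*\big(\tilde F_{[k]}(\mathcal P_k^\delta)-\mathcal M_{[k]}^\delta\big),$$ where $\omega_k=1$ if $\|\tilde F_{[k]}(\mathcal P_k^\delta)-\mathcal M_{[k]}^\delta\|>\tau\delta_{[k]}$ and $\omega_k=0$ otherwise, and $\alpha_k=\|s_k\|^2/\|\tilde F_{[k]}s_k\|^2$ if $\omega_k=1$, $\alpha_k=1$ if $\omega_k=0$. Stopping index. The iteration is terminated when, for the first time, all iterates are equal within a cycle: $k_*^\delta$ is the smallest multiple of $r_{\mathrm{num}}$ such that $\mathcal P_{k_*^\delta}^\delta=\mathcal P_{k_*^\delta+1}^\delta=\dots=\mathcal P_{k_*^\delta+r_{\mathrm{num}}-1}^\delta$.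
   Formalization: The stopping index requires all r_num steps of the cycle to leave the iterate unchanged (equality up to index k*+r_num, not k*+r_num−1); with the displayed chain the claim fails, e.g. for r_num=1, F_0=id, P_0=0, M_0=1, where k*=0 always. *)

theory Defs
  imports "HOL-Analysis.Analysis"
begin

text \<open>
  The pixel set \<open>{1..p\<^sub>h\<^sub>o\<^sub>r} \<times> {1..p\<^sub>v\<^sub>e\<^sub>r}\<close> is the index type \<open>'h \<times> 'v\<close>, with
  \<open>p\<^sub>h\<^sub>o\<^sub>r = CARD('h)\<close> and \<open>p\<^sub>v\<^sub>e\<^sub>r = CARD('v)\<close>; images are vectors over it, with the Euclidean
  norm and componentwise product of the vector type. For a set \<open>M\<close> of pixels, a function
  \<open>M \<rightarrow> \<complex>\<close> is represented by its extension by zero; this preserves sums, inner products and norms.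
\<close>

type_synonym ('h, 'v) image = "complex ^ ('h \<times> 'v)"

definition data_space :: "('h::finite \<times> 'v::finite) set \<Rightarrow> ('h, 'v) image set" where
  "data_space M = {g. \<forall>x. x \<notin> M \<longrightarrow> g $ x = 0}"

definition restr :: "('h::finite \<times> 'v::finite) set \<Rightarrow> ('h, 'v) image \<Rightarrow> ('h, 'v) image" where
  "restr M f = (\<chi> x. if x \<in> M then f $ x else 0)"

text \<open>
  \<open>enum\<close> is the fixed enumeration of the pixels by \<open>0, \<dots>, CARD('h) * CARD('v) - 1\<close>; the sum over
  the pixels \<open>y\<close> is the sum over all numbers \<open>n = enum y\<close>.
\<close>

definition dft ::
  "('h::finite \<times> 'v::finite \<Rightarrow> nat) \<Rightarrow> ('h, 'v) image \<Rightarrow> ('h, 'v) image" where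
  "dft enum f = (\<chi> x. \<Sum>y\<in>UNIV.
     f $ y * exp (- 2 * complex_of_real pi * \<i> * of_nat (enum y) * of_nat (enum x)
                  / of_nat (CARD('h) * CARD('v))))"

definition mri_op ::
  "('h::finite \<times> 'v::finite \<Rightarrow> nat) \<Rightarrow> ('h \<times> 'v) set \<Rightarrow> nat \<Rightarrow> (nat \<Rightarrow> ('h, 'v) image)
    \<Rightarrow> (nat \<Rightarrow> nat \<Rightarrow> complex) \<Rightarrow> nat \<Rightarrow> ('h, 'v) image \<Rightarrow> ('h, 'v) image" where
  "mri_op enum M bnum Bas b i P = (\<Sum>n = 1..bnum. b i n *s restr M (dft enum (P * Bas n)))"

definition cinner :: "complex ^ 'n::finite \<Rightarrow> complex ^ 'n \<Rightarrow> complex" where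
  "cinner f g = (\<Sum>x\<in>UNIV. f $ x * cnj (g $ x))"

text \<open>
  The adjoint for the complex inner product; the library constant \<open>adjoint\<close> refers to the real
  inner product instead.
\<close>

definition cadjoint ::
  "(complex ^ 'n::finite \<Rightarrow> complex ^ 'k::finite) \<Rightarrow> complex ^ 'k \<Rightarrow> complex ^ 'n" where
  "cadjoint F g = (THE h. \<forall>f. cinner (F f) g = cinner f h)"

text \<open>
  One step of the loping iteration for the equation \<open>F P = d\<close> with noise level \<open>\<epsilon>\<close>,
  taken at the iterate \<open>P\<close>.
\<close>

definition lsdk_direction ::
  "(complex ^ 'n::finite \<Rightarrow> complex ^ 'k::finite) \<Rightarrow> complex ^ 'k \<Rightarrow> complex ^ 'n \<Rightarrow> complex ^ 'n"
  where
  "lsdk_direction F d P = cadjoint F (F P - d)"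

definition lsdk_omega ::
  "real \<Rightarrow> (complex ^ 'n::finite \<Rightarrow> complex ^ 'k::finite) \<Rightarrow> complex ^ 'k \<Rightarrow> real
    \<Rightarrow> complex ^ 'n \<Rightarrow> real" where
  "lsdk_omega \<tau> F d \<epsilon> P = (if norm (F P - d) > \<tau> * \<epsilon> then 1 else 0)"

definition lsdk_alpha ::
  "real \<Rightarrow> (complex ^ 'n::finite \<Rightarrow> complex ^ 'k::finite) \<Rightarrow> complex ^ 'k \<Rightarrow> real
    \<Rightarrow> complex ^ 'n \<Rightarrow> real" where
  "lsdk_alpha \<tau> F d \<epsilon> P =
     (if lsdk_omega \<tau> F d \<epsilon> P = 1
      then (norm (lsdk_direction F d P))\<^sup>2 / (norm (F (lsdk_direction F d P)))\<^sup>2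
      else 1)"

definition lsdk_step ::
  "real \<Rightarrow> (complex ^ 'n::finite \<Rightarrow> complex ^ 'k::finite) \<Rightarrow> complex ^ 'k \<Rightarrow> real
    \<Rightarrow> complex ^ 'n \<Rightarrow> complex ^ 'n" where
  "lsdk_step \<tau> F d \<epsilon> P =
     P - (lsdk_omega \<tau> F d \<epsilon> P * lsdk_alpha \<tau> F d \<epsilon> P) *\<^sub>R lsdk_direction F d P"

primrec lsdk ::
  "real \<Rightarrow> nat \<Rightarrow> (nat \<Rightarrow> complex ^ 'n::finite \<Rightarrow> complex ^ 'k::finite) \<Rightarrow> (nat \<Rightarrow> complex ^ 'k)
    \<Rightarrow> (nat \<Rightarrow> real) \<Rightarrow> complex ^ 'n \<Rightarrow> nat \<Rightarrow> complex ^ 'n" where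
  "lsdk \<tau> r F d \<epsilon> P0 0 = P0"
| "lsdk \<tau> r F d \<epsilon> P0 (Suc k) =
     lsdk_step \<tau> (F (k mod r)) (d (k mod r)) (\<epsilon> (k mod r)) (lsdk \<tau> r F d \<epsilon> P0 k)"

text \<open>
  The first multiple \<open>k\<close> of \<open>r\<close> such that none of the \<open>r\<close> steps of the cycle starting at \<open>k\<close>
  changes the iterate. All \<open>r\<close> steps have to be tested, hence \<open>j \<le> r\<close>: comparing only
  \<open>P k, \<dots>, P (k + r - 1)\<close> would ignore the last equation of the cycle (and for \<open>r = 1\<close>
  would always stop at \<open>0\<close>).
\<close>

definition stopping_index :: "nat \<Rightarrow> (nat \<Rightarrow> 'a) \<Rightarrow> nat" where
  "stopping_index r P = (LEAST k. r dvd k \<and> (\<forall>j\<le>r. P (k + j) = P k))"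

end

theory Submission
  imports Defs
begin

text \<open>
  Write \<open>N\<close> for the intersection of the kernels of the \<open>F i\<close>, and let \<open>x\<close>
  be a solution of the exact system.

  An active step along \<open>s = F\<^sup>* (F P - d)\<close> strictly decreases the distance to \<open>x\<close>: it
  lowers the squared error by at least \<open>\<tau> (\<tau> - 2) \<epsilon>\<^sup>2 / K\<^sup>2\<close>, where \<open>K\<close> bounds \<open>F\<close>
  (\<open>steepest_descent_error_decrease\<close>). For a fixed noise level this amount is a fixed positive
  number for each equation, while the squared errors decrease and are nonnegative. So only
  finitely many steps are active, some cycle is passed without a change, and the stopping index
  exists. Since active steps do change the iterate, at the stopping index every
  residual is at most \<open>\<tau>\<close> times its noise level (\<open>lsdk_residual_at_stopping\<close>). Hence
  \<open>F i P\<^sub>k\<^sub>*\<close> tends to the exact datum for each \<open>i\<close>.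

  It remains to pass from small residuals to convergence of the iterates, and here finite
  dimension replaces any comparison with the noise-free iteration. All steps are taken
  in ranges of adjoints, so every iterate lies in \<open>P0 + N\<^sup>\<bottom>\<close> (\<open>lsdk_orthogonal_to_kernels\<close>). This
  affine space contains exactly one solution \<open>Q\<close>, obtained from \<open>x\<close> by removing the \<open>N\<close>-component
  of \<open>x - P0\<close>. On \<open>N\<^sup>\<bottom>\<close> the family of operators is jointly injective, hence bounded below, and so
  \<open>F i (P\<^sub>k\<^sub>* - Q) \<rightarrow> 0\<close> for all \<open>i\<close> forces \<open>P\<^sub>k\<^sub>* \<rightarrow> Q\<close>
  (\<open>tendsto_zero_if_images_tendsto_zero\<close>). In particular the limit is the solution closest to \<open>P0\<close>.
\<close>

section \<open>The complex adjoint and the real adjoint\<close>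

text \<open>
  Since norms and distances see only this real part, all estimates below can be carried out in the
  underlying real Euclidean space.
\<close>

lemma Re_cinner: "Re (cinner f g) = inner f g"
  by (simp add: cinner_def inner_vec_def inner_complex_def)

lemma cinner_mult_left: "cinner (c *s f) g = c * cinner f g"
  by (simp add: cinner_def sum_distrib_left mult.assoc)

text \<open>
  Complex homogeneity is what makes the two adjoints agree: the real adjoint identity fixes the
  real parts, and applied to \<open>\<i> f\<close> it also fixes the imaginary parts.
\<close>

lemma cadjoint_eq_adjoint:
  fixes F :: "complex ^ 'n::finite \<Rightarrow> complex ^ 'k::finite"
  assumes lin: "linear F" and scale: "\<And>c f. F (c *s f) = c *s F f"
  shows "cadjoint F g = adjoint F g"
  unfolding cadjoint_def
proof (rule the_equality)
  show "\<forall>f. cinner (F f) g = cinner f (adjoint F g)"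
  proof
    fix f
    have re: "Re (cinner (F f) g) = Re (cinner f (adjoint F g))" for f
      by (simp add: Re_cinner adjoint_works[OF lin])
    have "Re (\<i> * cinner (F f) g) = Re (\<i> * cinner f (adjoint F g))"
      using re[of "\<i> *s f"] by (simp only: scale cinner_mult_left)
    then show "cinner (F f) g = cinner f (adjoint F g)"
      using re[of f] by (simp add: complex_eq_iff)
  qed
next
  fix h assume h: "\<forall>f. cinner (F f) g = cinner f h"
  have "inner f h = inner f (adjoint F g)" for f
    using h[rule_format, of f] adjoint_works[OF lin, of f g] by (metis Re_cinner)
  then show "h = adjoint F g"
    by (meson vector_eq_ldot)
qed

lemma dft_add: "dft enum (f + g) = dft enum f + dft enum g"
  by (simp add: dft_def vec_eq_iff distrib_right sum.distrib)

lemma dft_scale: "dft enum (c *s f) = c *s dft enum f"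
  by (simp add: dft_def vec_eq_iff sum_distrib_left mult.assoc)

lemma restr_add: "restr M (f + g) = restr M f + restr M g"
  by (simp add: restr_def vec_eq_iff)

lemma restr_scale: "restr M (c *s f) = c *s restr M f"
  by (simp add: restr_def vec_eq_iff)

lemma mri_op_add:
  "mri_op enum M bnum Bas b i (P + Q) = mri_op enum M bnum Bas b i P + mri_op enum M bnum Bas b i Q"
  by (simp add: mri_op_def distrib_right dft_add restr_add vector_add_ldistrib sum.distrib)

lemma mri_op_scale:
  "mri_op enum M bnum Bas b i (c *s P) = c *s mri_op enum M bnum Bas b i P"
proof -
  have "(c *s P) * Bas n = c *s (P * Bas n)" for n
    by (simp add: vec_eq_iff mult.assoc)
  then show ?thesis
    by (simp add: mri_op_def dft_scale restr_scale vec.scale_sum_right vector_smult_assoc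
        mult.commute)
qed

lemma linear_mri_op:
  fixes enum :: "'h::finite \<times> 'v::finite \<Rightarrow> nat"
  shows "linear (mri_op enum M bnum Bas b i)"
proof (rule linearI)
  fix c :: real and P :: "('h, 'v) image"
  have "x *\<^sub>R Q = complex_of_real x *s Q" for x and Q :: "('h, 'v) image"
    by (simp add: vec_eq_iff complex_eq_iff)
  then show "mri_op enum M bnum Bas b i (c *\<^sub>R P) = c *\<^sub>R mri_op enum M bnum Bas b i P"
    by (simp add: mri_op_scale)
qed (rule mri_op_add)

section \<open>Error decrease in an active step\<close>

text \<open>
  Let \<open>r = F P - d\<close>. The cross term of the expanded square is controlled by
  \<open>\<langle>s, P - x\<rangle> = \<langle>r, F P - F x\<rangle> \<ge> \<parallel>r\<parallel> (\<parallel>r\<parallel> - \<epsilon>)\<close>, and the quadratic term by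
  \<open>a \<parallel>s\<parallel>\<^sup>2 \<le> \<parallel>r\<parallel>\<^sup>2\<close>, which follows from \<open>\<parallel>s\<parallel>\<^sup>2 = \<langle>F s, r\<rangle>\<close> and Cauchy-Schwarz. So the gain
  is \<open>a \<parallel>r\<parallel> (\<parallel>r\<parallel> - 2 \<epsilon>)\<close>: this is where \<open>\<tau> > 2\<close> enters.
\<close>

lemma steepest_descent_error_decrease:
  fixes F :: "'a::euclidean_space \<Rightarrow> 'b::euclidean_space"
  assumes lin: "linear F" and K: "K > 0" "\<And>v. norm (F v) \<le> K * norm v"
    and noise: "norm (d - F x) \<le> \<epsilon>" and pos: "\<epsilon> > 0" "\<tau> > 2"
    and active: "norm (F P - d) > \<tau> * \<epsilon>"
  defines "s \<equiv> adjoint F (F P - d)"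
  defines "a \<equiv> (norm s)\<^sup>2 / (norm (F s))\<^sup>2"
  shows "(norm (P - a *\<^sub>R s - x))\<^sup>2 \<le> (norm (P - x))\<^sup>2 - \<tau> * (\<tau> - 2) * \<epsilon>\<^sup>2 / K\<^sup>2"
proof -
  define r where "r = F P - d"
  have adj: "inner v s = inner (F v) r" for v
    unfolding s_def r_def by (simp add: adjoint_works[OF lin])
  have r: "norm r > \<tau> * \<epsilon>" using active by (simp add: r_def)
  have r2: "norm r > 2 * \<epsilon>"
    using r pos mult_strict_right_mono[of 2 \<tau> \<epsilon>] by linarith
  have r_pos: "norm r > 0" using r2 pos by linarith
  have cross: "inner (P - x) s \<ge> norm r * (norm r - \<epsilon>)"
  proof -
    have "F (P - x) = r + (d - F x)"
      by (simp add: r_def linear_diff[OF lin])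
    then have "inner (P - x) s = (norm r)\<^sup>2 + inner (d - F x) r"
      by (simp add: adj inner_add_left power2_norm_eq_inner)
    moreover have "\<bar>inner (d - F x) r\<bar> \<le> \<epsilon> * norm r"
      using Cauchy_Schwarz_ineq2[of "d - F x" r] noise
      by (meson mult_right_mono norm_ge_zero order_trans)
    ultimately show ?thesis by (simp add: power2_eq_square algebra_simps)
  qed
  \<comment> \<open>Neither \<open>s\<close> nor \<open>F s\<close> vanishes, so the quotient \<open>a\<close> is a genuine one and the step moves \<open>P\<close>.\<close>
  have "norm r * (norm r - \<epsilon>) > 0" using r_pos r2 pos by simp
  then have s_nz: "norm s > 0" using cross by auto
  have ss: "(norm s)\<^sup>2 \<le> norm (F s) * norm r"
    using Cauchy_Schwarz_ineq2[of "F s" r] adj[of s] by (simp add: power2_norm_eq_inner)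
  then have Fs: "norm (F s) > 0" using s_nz
    by (metis linorder_not_le mult_zero_left norm_ge_zero norm_le_zero_iff norm_zero
        zero_less_power)
  have a_ge: "a \<ge> 1 / K\<^sup>2"
  proof -
    have "(norm (F s))\<^sup>2 \<le> K\<^sup>2 * (norm s)\<^sup>2"
      using power_mono[OF K(2)[of s], of 2] by (simp add: power_mult_distrib)
    then show ?thesis using Fs K(1) by (simp add: a_def field_simps)
  qed
  have a_ss: "a * (norm s)\<^sup>2 \<le> (norm r)\<^sup>2"
  proof -
    have "((norm s)\<^sup>2)\<^sup>2 \<le> (norm (F s))\<^sup>2 * (norm r)\<^sup>2"
      using power_mono[OF ss, of 2] by (simp add: power_mult_distrib)
    then show ?thesis using Fs by (simp add: a_def field_simps power2_eq_square)
  qed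
  have a_nonneg: "a \<ge> 0" by (simp add: a_def)
  have gain: "norm r * (norm r - 2 * \<epsilon>) \<ge> \<tau> * (\<tau> - 2) * \<epsilon>\<^sup>2"
  proof -
    have "(\<tau> * \<epsilon>) * (\<tau> * \<epsilon> - 2 * \<epsilon>) \<le> norm r * (norm r - 2 * \<epsilon>)"
      using r r2 pos by (intro mult_mono) (auto simp: mult_right_mono)
    then show ?thesis by (simp add: power2_eq_square algebra_simps)
  qed
  have "(norm (P - a *\<^sub>R s - x))\<^sup>2
      = (norm (P - x))\<^sup>2 - 2 * a * inner (P - x) s + a * (a * (norm s)\<^sup>2)"
    by (simp add: power2_norm_eq_inner inner_diff inner_commute algebra_simps)
  also have "\<dots> \<le> (norm (P - x))\<^sup>2 - 2 * a * (norm r * (norm r - \<epsilon>)) + a * (norm r)\<^sup>2"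
    using mult_left_mono[OF cross a_nonneg] mult_left_mono[OF a_ss a_nonneg] by simp
  also have "\<dots> = (norm (P - x))\<^sup>2 - a * (norm r * (norm r - 2 * \<epsilon>))"
    by (simp add: power2_eq_square algebra_simps)
  also have "\<dots> \<le> (norm (P - x))\<^sup>2 - (1 / K\<^sup>2) * (\<tau> * (\<tau> - 2) * \<epsilon>\<^sup>2)"
    using mult_mono[OF a_ge gain a_nonneg] pos by simp
  finally show ?thesis by simp
qed

section \<open>The loping iteration for a fixed noise level\<close>

lemma lsdk_step_inactive:
  "norm (F P - d) \<le> \<tau> * \<epsilon> \<Longrightarrow> lsdk_step \<tau> F d \<epsilon> P = P"
  by (simp add: lsdk_step_def lsdk_omega_def)

lemma lsdk_step_active:
  assumes "norm (F P - d) > \<tau> * \<epsilon>" and "cadjoint F (F P - d) = adjoint F (F P - d)"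
  shows "lsdk_step \<tau> F d \<epsilon> P
    = P - ((norm (adjoint F (F P - d)))\<^sup>2 / (norm (F (adjoint F (F P - d))))\<^sup>2)
          *\<^sub>R adjoint F (F P - d)"
  using assms by (simp add: lsdk_step_def lsdk_omega_def lsdk_alpha_def lsdk_direction_def)

text \<open>The directions of the steps are values of adjoints, and these are orthogonal to the kernels.\<close>

lemma lsdk_orthogonal_to_kernels:
  assumes lin: "\<And>i. i < r \<Longrightarrow> linear (F i)"
    and adj: "\<And>i g. i < r \<Longrightarrow> cadjoint (F i) g = adjoint (F i) g"
    and "r > 0" and ker: "\<And>i. i < r \<Longrightarrow> F i v = 0"
  shows "inner v (lsdk \<tau> r F d \<epsilon> P0 k - P0) = 0"
proof (induction k)
  case (Suc k)
  define i where "i = k mod r"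
  define P where "P = lsdk \<tau> r F d \<epsilon> P0 k"
  have i: "i < r" using \<open>r > 0\<close> by (simp add: i_def)
  have "inner v (adjoint (F i) g) = 0" for g
    by (simp add: adjoint_works[OF lin[OF i]] ker[OF i])
  then have "inner v (lsdk_step \<tau> (F i) (d i) (\<epsilon> i) P) = inner v P"
    by (simp add: lsdk_step_def lsdk_direction_def adj[OF i] inner_diff_right)
  then show ?case using Suc by (simp add: inner_diff_right i_def P_def)
qed simp

text \<open>
  What matters here is that the guaranteed gain \<open>c\<close> depends on the equation and the noise level
  only, uniformly in the iterate \<open>P\<close>.
\<close>

lemma lsdk_step_error_decrease:
  fixes F :: "complex ^ 'n::finite \<Rightarrow> complex ^ 'k::finite"
  assumes lin: "linear F" and adj: "\<And>g. cadjoint F g = adjoint F g"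
    and noise: "norm (d - F x) \<le> \<epsilon>" and pos: "\<epsilon> > 0" "\<tau> > 2"
  obtains c where "c > 0"
    and "\<And>P. norm (F P - d) > \<tau> * \<epsilon> \<Longrightarrow>
           (norm (lsdk_step \<tau> F d \<epsilon> P - x))\<^sup>2 \<le> (norm (P - x))\<^sup>2 - c"
proof -
  obtain K where K: "K > 0" "\<And>v. norm (F v) \<le> K * norm v"
    using linear_bounded_pos[OF lin] by blast
  show thesis
  proof
    show "\<tau> * (\<tau> - 2) * \<epsilon>\<^sup>2 / K\<^sup>2 > 0" using K pos by simp
    show "(norm (lsdk_step \<tau> F d \<epsilon> P - x))\<^sup>2 \<le> (norm (P - x))\<^sup>2 - \<tau> * (\<tau> - 2) * \<epsilon>\<^sup>2 / K\<^sup>2"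
      if "norm (F P - d) > \<tau> * \<epsilon>" for P
      using steepest_descent_error_decrease[OF lin K noise pos that]
      by (simp add: lsdk_step_active[where F = F, OF that adj])
  qed
qed

text \<open>
  Existence of the stopping index: the squared errors form a convergent sequence, so their
  increments tend to zero and eventually fall below the gain that every active step guarantees.
  From then on all steps are idle. Conversely, a step that fixes the iterate cannot be active, so
  the discrepancy bound holds for every equation when the iteration stops.
\<close>

lemma lsdk_residual_at_stopping:
  fixes F :: "nat \<Rightarrow> complex ^ 'n::finite \<Rightarrow> complex ^ 'k::finite" and start :: "complex ^ 'n"
  assumes lin: "\<And>i. i < r \<Longrightarrow> linear (F i)"
    and adj: "\<And>i g. i < r \<Longrightarrow> cadjoint (F i) g = adjoint (F i) g"
    and "\<tau> > 2"
    and noise: "\<And>i. i < r \<Longrightarrow> norm (d i - F i x) \<le> \<epsilon> i"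
    and pos: "\<And>i. i < r \<Longrightarrow> \<epsilon> i > 0"
    and i: "i < r"
  defines "P \<equiv> lsdk \<tau> r F d \<epsilon> start"
  shows "norm (F i (P (stopping_index r P)) - d i) \<le> \<tau> * \<epsilon> i"
proof -
  have "r > 0" using i by simp
  have "\<exists>c>0. \<forall>P. norm (F i P - d i) > \<tau> * \<epsilon> i \<longrightarrow>
           (norm (lsdk_step \<tau> (F i) (d i) (\<epsilon> i) P - x))\<^sup>2 \<le> (norm (P - x))\<^sup>2 - c"
    if "i < r" for i
    using lsdk_step_error_decrease[OF lin adj noise pos \<open>\<tau> > 2\<close>, of i] that by metis
  then obtain c where c: "\<And>i. i < r \<Longrightarrow> c i > 0"
    "\<And>i P. i < r \<Longrightarrow> norm (F i P - d i) > \<tau> * \<epsilon> i \<Longrightarrow>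
       (norm (lsdk_step \<tau> (F i) (d i) (\<epsilon> i) P - x))\<^sup>2 \<le> (norm (P - x))\<^sup>2 - c i"
    by metis
  define E where "E k = (norm (P k - x))\<^sup>2" for k
  have P_Suc: "P (Suc k) =
      lsdk_step \<tau> (F (k mod r)) (d (k mod r)) (\<epsilon> (k mod r)) (P k)" for k
    by (simp add: P_def)
  have active: "E (Suc k) \<le> E k - c (k mod r)"
    if "norm (F (k mod r) (P k) - d (k mod r)) > \<tau> * \<epsilon> (k mod r)" for k
    using c(2)[OF _ that] \<open>r > 0\<close> by (simp add: E_def P_Suc)
  have idle: "P (Suc k) = P k"
    if "\<not> norm (F (k mod r) (P k) - d (k mod r)) > \<tau> * \<epsilon> (k mod r)" for k
    using that by (simp add: P_Suc lsdk_step_inactive)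
  have c_pos: "c (k mod r) > 0" for k using c(1) \<open>r > 0\<close> by simp
  have "E (Suc k) \<le> E k" for k
    using active[of k] idle[of k] c_pos[of k] by (fastforce simp: E_def)
  then have "decseq E" by (rule decseq_SucI)
  then obtain L where L: "E \<longlonglongrightarrow> L"
    using decseq_convergent[of E 0] by (auto simp: E_def)
  have "(\<lambda>k. E k - E (Suc k)) \<longlonglongrightarrow> 0"
    using tendsto_diff[OF L LIMSEQ_Suc[OF L]] by simp
  then have "\<forall>\<^sub>F k in sequentially. \<forall>i\<in>{..<r}. E k - E (Suc k) < c i"
    using c(1) by (intro eventually_ball_finite) (auto intro: order_tendstoD(2))
  then obtain n where n: "\<And>k i. k \<ge> n \<Longrightarrow> i < r \<Longrightarrow> E k - E (Suc k) < c i"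
    unfolding eventually_sequentially by blast
  have tail: "P (Suc k) = P k" if "k \<ge> n" for k
    using n[OF that, of "k mod r"] active[of k] idle[of k] \<open>r > 0\<close> by force
  have const: "P (r * n + j) = P (r * n)" for j
  proof (induction j)
    case (Suc j)
    have "n \<le> r * n + j" using \<open>r > 0\<close> by (simp add: trans_le_add1)
    then show ?case using tail Suc by simp
  qed simp
  let ?k = "stopping_index r P"
  have "r dvd ?k \<and> (\<forall>j\<le>r. P (?k + j) = P ?k)"
    unfolding stopping_index_def by (rule LeastI_ex) (use const in \<open>auto intro!: exI[of _ "r * n"]\<close>)
  then have dvd: "r dvd ?k" and cyc: "P (?k + j) = P ?k" if "j \<le> r" for j
    using that by auto
  \<comment> \<open>Equation \<open>i\<close> is used in the step from \<open>?k + i\<close> to \<open>?k + i + 1\<close>, which lies in the unchanged cycle.\<close>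
  have m: "(?k + i) mod r = i"
    using dvd[of 0] i by (simp add: mod_add_left_eq[symmetric])
  have "P (?k + i) = P ?k" "P (Suc (?k + i)) = P ?k"
    using cyc[of i] cyc[of "Suc i"] i by simp_all
  then have "\<not> norm (F i (P ?k) - d i) > \<tau> * \<epsilon> i"
    using active[of "?k + i"] c(1)[OF i] by (auto simp: m E_def)
  then show ?thesis by simp
qed

section \<open>From small residuals to small errors\<close>

text \<open>
  The operator \<open>\<Sum>\<^sub>i F\<^sub>i\<^sup>* F\<^sub>i\<close> packs the family into a single one with the same kernel, since
  \<open>\<langle>v, \<Sum>\<^sub>i F\<^sub>i\<^sup>* F\<^sub>i v\<rangle> = \<Sum>\<^sub>i \<parallel>F\<^sub>i v\<parallel>\<^sup>2\<close>. On the orthogonal complement of this kernel it is injective, and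
  in finite dimension injectivity gives a lower bound.
\<close>

lemma tendsto_zero_if_images_tendsto_zero:
  fixes F :: "nat \<Rightarrow> 'a::euclidean_space \<Rightarrow> 'b::euclidean_space" and e :: "nat \<Rightarrow> 'a"
  assumes lin: "\<And>i. i < r \<Longrightarrow> linear (F i)"
    and orth: "\<And>m v. (\<And>i. i < r \<Longrightarrow> F i v = 0) \<Longrightarrow> inner v (e m) = 0"
    and lim: "\<And>i. i < r \<Longrightarrow> (\<lambda>m. F i (e m)) \<longlonglongrightarrow> 0"
  shows "e \<longlonglongrightarrow> 0"
proof -
  define N where "N = {v. \<forall>i<r. F i v = 0}"
  define S where "S = {x. \<forall>v\<in>N. orthogonal v x}"
  define T where "T v = (\<Sum>i<r. adjoint (F i) (F i v))" for v
  have S: "subspace S"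
    unfolding S_def by (rule subspace_orthogonal_to_vectors)
  have linT: "linear T"
    unfolding T_def
    by (intro linear_compose_sum ballI)
      (use lin in \<open>auto intro: linear_compose[unfolded o_def] adjoint_linear\<close>)
  have quad: "inner v (T v) = (\<Sum>i<r. (norm (F i v))\<^sup>2)" for v
    unfolding T_def inner_sum_right
    by (rule sum.cong) (simp_all add: adjoint_works lin power2_norm_eq_inner)
  have inj: "\<forall>v\<in>S. T v = 0 \<longrightarrow> v = 0"
  proof (intro ballI impI)
    fix v assume "v \<in> S" "T v = 0"
    then have "(\<Sum>i<r. (norm (F i v))\<^sup>2) = 0" using quad[of v] by simp
    then have "v \<in> N" by (simp add: sum_nonneg_eq_0_iff N_def)
    then show "v = 0" using \<open>v \<in> S\<close> by (auto simp: S_def orthogonal_def)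
  qed
  obtain c where c: "c > 0" "\<forall>v\<in>S. c * norm v \<le> norm (T v)"
    using injective_imp_isometric[OF closed_subspace[OF S] S _ inj] linT
    by (auto simp: linear_conv_bounded_linear mult.commute)
  have "e m \<in> S" for m
    using orth by (auto simp: S_def N_def orthogonal_def)
  then have bound: "norm (e m) \<le> norm (T (e m)) / c" for m
    using c by (simp add: field_simps)
  have "(\<lambda>m. adjoint (F i) (F i (e m))) \<longlonglongrightarrow> 0" if "i < r" for i
    using linear_lim_0 bounded_linear.tendsto_zero lim[OF that]
      adjoint_linear[OF lin[OF that]] linear_conv_bounded_linear by blast
  then have "(\<lambda>m. T (e m)) \<longlonglongrightarrow> 0"
    unfolding T_def by (intro tendsto_null_sum) auto
  then have "(\<lambda>m. norm (T (e m)) / c) \<longlonglongrightarrow> 0"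
    by (auto intro: tendsto_eq_intros tendsto_norm_zero tendsto_divide_zero)
  then show ?thesis
    by (rule Lim_null_comparison[rotated]) (simp add: bound)
qed

section \<open>Convergence of the stopped iterates\<close>

theorem theorem4p3:
  fixes enum :: "'h::finite \<times> 'v::finite \<Rightarrow> nat"
    and M :: "('h \<times> 'v) set"
    and r_num b_num :: nat
    and Bas :: "nat \<Rightarrow> ('h, 'v) image"
    and b :: "nat \<Rightarrow> nat \<Rightarrow> complex"
    and F :: "nat \<Rightarrow> ('h, 'v) image \<Rightarrow> ('h, 'v) image"
    and \<tau> \<rho> :: real
    and P0 :: "('h, 'v) image"
    and data :: "nat \<Rightarrow> ('h, 'v) image"
    and \<delta> :: "nat \<Rightarrow> nat \<Rightarrow> real"
    and noisy :: "nat \<Rightarrow> nat \<Rightarrow> ('h, 'v) image"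
    and iter :: "nat \<Rightarrow> nat \<Rightarrow> ('h, 'v) image"
    and kstar :: "nat \<Rightarrow> nat"
  assumes enum: "bij_betw enum UNIV {..<CARD('h) * CARD('v)}"
    and "r_num > 0" and "b_num > 0"
    and F_def: "F = mri_op enum M b_num Bas b"
    and "\<tau> > 2" and "\<rho> > 0"
    and data: "\<forall>i<r_num. data i \<in> data_space M"
    and solvable: "\<exists>P \<in> cball P0 (\<rho> / 2). \<forall>i<r_num. F i P = data i"
    and delta_pos: "\<forall>m. \<forall>i<r_num. \<delta> m i > 0"
    and delta_lim: "(\<lambda>m. Max (\<delta> m ` {..<r_num})) \<longlonglongrightarrow> 0"
    and noisy: "\<forall>m. \<forall>i<r_num. noisy m i \<in> data_space M"
    and noise: "\<forall>m. \<forall>i<r_num. norm (noisy m i - data i) \<le> \<delta> m i"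
    and iter_def: "\<forall>m. iter m = lsdk \<tau> r_num F (noisy m) (\<delta> m) P0"
    and kstar_def: "\<forall>m. kstar m = stopping_index r_num (iter m)"
  shows "\<exists>P. (\<forall>i<r_num. F i P = data i) \<and> (\<lambda>m. iter m (kstar m)) \<longlonglongrightarrow> P"
proof -
  have lin: "linear (F i)" for i
    unfolding F_def by (rule linear_mri_op)
  have adj: "cadjoint (F i) g = adjoint (F i) g" for i g
    by (rule cadjoint_eq_adjoint[OF lin]) (simp add: F_def mri_op_scale)
  obtain x where x: "\<And>i. i < r_num \<Longrightarrow> F i x = data i" using solvable by blast

  \<comment> \<open>The solution in \<open>P0 + N\<^sup>\<bottom>\<close>: remove from \<open>x - P0\<close> its component \<open>y\<close> in the common kernel.\<close>
  define N where "N = {v. \<forall>i<r_num. F i v = 0}"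
  have N: "subspace N"
    unfolding N_def subspace_def by (auto simp: linear_0 linear_add linear_scale lin)
  obtain y z where yz: "y \<in> span N" "\<And>w. w \<in> span N \<Longrightarrow> orthogonal z w" "x - P0 = y + z"
    using orthogonal_subspace_decomp_exists[of N "x - P0"] by metis
  define Q where "Q = P0 + z"
  have "Q = x - y" using yz(3) by (simp add: Q_def algebra_simps)
  moreover have "y \<in> N" using yz(1) N by (metis span_eq_iff)
  ultimately have Q: "F i Q = data i" if "i < r_num" for i
    using that x by (simp add: linear_diff[OF lin] N_def)

  have delta_i: "(\<lambda>m. \<delta> m i) \<longlonglongrightarrow> 0" if "i < r_num" for i
  proof (rule tendsto_sandwich[OF _ _ tendsto_const delta_lim])
    show "\<forall>\<^sub>F m in sequentially. 0 \<le> \<delta> m i"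
      using delta_pos that by (auto intro: always_eventually less_imp_le)
    show "\<forall>\<^sub>F m in sequentially. \<delta> m i \<le> Max (\<delta> m ` {..<r_num})"
      using that by (intro always_eventually allI Max_ge) auto
  qed
  have "(\<lambda>m. iter m (kstar m) - Q) \<longlonglongrightarrow> 0"
  proof (rule tendsto_zero_if_images_tendsto_zero[where F = F and r = r_num, OF lin])
    fix m v assume ker: "\<And>i. i < r_num \<Longrightarrow> F i v = 0"
    have "inner v (iter m (kstar m) - P0) = 0"
      using lsdk_orthogonal_to_kernels[OF lin adj \<open>r_num > 0\<close> ker] iter_def by simp
    moreover have "inner v z = 0"
      using yz(2)[of v] ker
      by (simp add: span_base N_def orthogonal_def inner_commute)
    ultimately show "inner v (iter m (kstar m) - Q) = 0"
      by (simp add: Q_def inner_diff_right inner_add_right)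
  next
    fix i assume i: "i < r_num"
    have "norm (F i (iter m (kstar m) - Q)) \<le> (\<tau> + 1) * \<delta> m i" for m
    proof -
      have "norm (F i (iter m (kstar m)) - noisy m i) \<le> \<tau> * \<delta> m i"
        using lsdk_residual_at_stopping[where F = F and r = r_num and d = "noisy m" and x = x
            and \<epsilon> = "\<delta> m" and start = P0, OF lin adj \<open>\<tau> > 2\<close> _ _ i] noise delta_pos x
        by (simp add: iter_def kstar_def)
      moreover have "norm (noisy m i - data i) \<le> \<delta> m i" using noise i by blast
      ultimately have "norm (F i (iter m (kstar m)) - data i) \<le> \<tau> * \<delta> m i + \<delta> m i"
        using norm_triangle_ineq[of "F i (iter m (kstar m)) - noisy m i" "noisy m i - data i"]
        by simp
      then show ?thesis by (simp add: linear_diff[OF lin] Q i algebra_simps)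
    qed
    then show "(\<lambda>m. F i (iter m (kstar m) - Q)) \<longlonglongrightarrow> 0"
      by (intro Lim_null_comparison[OF _ tendsto_mult_right_zero[OF delta_i[OF i]]])
        (auto intro: always_eventually)
  qed
  then have "(\<lambda>m. iter m (kstar m)) \<longlonglongrightarrow> Q" by (simp add: LIM_zero_iff)
  then show ?thesis using Q by blast
qed

end
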